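(* Let $Z$ be a topological space and let $Y$ be a locally $Z$-bounded space. Then the topology $t^Z_{1,s}$ on $C(Y,Z)$ is admissible.
   Context: For a topological space $X$, $\mathcal{O}(X)$ denotes the family of all open subsets of $X$. $C(Y,Z)$ is the set of all continuous maps from $Y$ to $Z$, and $\mathcal{O}_Z(Y)=\{f^{-1}(U): f\in C(Y,Z),\ U\in\mathcal{O}(Z)\}$. $\tau_Y^Z$ is the topology on $Y$ having $\mathcal{O}_Z(Y)$ as a subbasis. A subset $K$ of a space $X$ is bounded (in $X$) if every open cover of $X$ has a finite subcollection covering $K$. A subset $B\subseteq Y$ is $Z$-bounded if it is bounded in the space $(Y,\tau_Y^Z)$. The space $Y$ is locally $Z$-bounded if for every $y\in Y$ and every open neighborhood $U$ of $y$ there is a $Z$-bounded neighborhood $g^{-1}(V)\in\mathcal{O}_Z(Y)$ of $y$ with $g^{-1}(V)\subseteq U$. $\tau_{1,s}^Z$ is the family of all $\mathbb{H}\subseteq\mathcal{O}(Y)$ such that: ($\alpha$) if $A\in\mathbb{H}\cap\mathcal{O}_Z(Y)$, $V\in\mathcal{O}(Y)$ and $A\subseteq V$, then $V\in\mathbb{H}$; and ($\beta$) every collection of elements of $\mathcal{O}_Z(Y)$ whose union equals $Y$ has a finite subcollection whose union belongs to $\mathbb{H}$. The topology $t_{1,s}^Z$ on $C(Y,Z)$ has as a subbasis all sets $(\mathbb{H},U)=\{f\in C(Y,Z): f^{-1}(U)\in\mathbb{H}\}$ with $\mathbb{H}\in\tau_{1,s}^Z$ and $U\in\mathcal{O}(Z)$.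 A topology $t$ on $C(Y,Z)$ is admissible if for every space $X$ and every map $G:X\to C(Y,Z)$, continuity of $G:X\to (C(Y,Z),t)$ implies continuity of $\widetilde{G}:X\times Y\to Z$, $\widetilde{G}(x,y)=G(x)(y)$; equivalently, the evaluation map $e:(C(Y,Z),t)\times Y\to Z$, $e(f,y)=f(y)$, is continuous. *)

theory Defs
  imports "HOL-Analysis.Analysis"
begin

text \<open>Spaces are values of type \<^typ>\<open>'a topology\<close>, so empty spaces are allowed.\<close>

definition preimage :: "'y topology \<Rightarrow> ('y \<Rightarrow> 'z) \<Rightarrow> 'z set \<Rightarrow> 'y set" where
  "preimage Y f U = {y \<in> topspace Y. f y \<in> U}"

text \<open>Restricting to extensional functions makes an element of \<open>contmaps Y Z\<close> determined by
  its values on \<open>topspace Y\<close>, as for maps \<open>Y \<rightarrow> Z\<close> in the set-theoretic sense.\<close>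

definition contmaps :: "'y topology \<Rightarrow> 'z topology \<Rightarrow> ('y \<Rightarrow> 'z) set" where
  "contmaps Y Z = {f \<in> extensional (topspace Y). continuous_map Y Z f}"

text \<open>The topology on \<open>S\<close> with subbasis \<open>\<B>\<close>. Unlike \<^const>\<open>topology_generated_by\<close>, its
  underlying set is \<open>S\<close> even if \<open>\<B>\<close> does not cover \<open>S\<close> (the empty intersection is \<open>S\<close>).\<close>

definition subbasis_topology :: "'a set \<Rightarrow> 'a set set \<Rightarrow> 'a topology" where
  "subbasis_topology S \<B> =
     topology (arbitrary union_of (finite intersection_of (\<lambda>B. B \<in> \<B>) relative_to S))"

definition O_Z :: "'y topology \<Rightarrow> 'z topology \<Rightarrow> 'y set set" where
  "O_Z Y Z = {preimage Y f U | f U. f \<in> contmaps Y Z \<and> openin Z U}"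

definition tau_YZ :: "'y topology \<Rightarrow> 'z topology \<Rightarrow> 'y topology" where
  "tau_YZ Y Z = subbasis_topology (topspace Y) (O_Z Y Z)"

definition bounded_in :: "'a topology \<Rightarrow> 'a set \<Rightarrow> bool" where
  "bounded_in X K \<longleftrightarrow> K \<subseteq> topspace X \<and>
     (\<forall>\<U>. (\<forall>U\<in>\<U>. openin X U) \<and> \<Union>\<U> = topspace X \<longrightarrow>
        (\<exists>\<F>. finite \<F> \<and> \<F> \<subseteq> \<U> \<and> K \<subseteq> \<Union>\<F>))"

definition Z_bounded :: "'y topology \<Rightarrow> 'z topology \<Rightarrow> 'y set \<Rightarrow> bool" where
  "Z_bounded Y Z B \<longleftrightarrow> bounded_in (tau_YZ Y Z) B"

definition locally_Z_bounded :: "'y topology \<Rightarrow> 'z topology \<Rightarrow> bool" where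
  "locally_Z_bounded Y Z \<longleftrightarrow>
     (\<forall>y U. openin Y U \<and> y \<in> U \<longrightarrow>
        (\<exists>W \<in> O_Z Y Z. Z_bounded Y Z W \<and> y \<in> W \<and> W \<subseteq> U))"

definition tau_1s :: "'y topology \<Rightarrow> 'z topology \<Rightarrow> 'y set set set" where
  "tau_1s Y Z = {\<H>. \<H> \<subseteq> {A. openin Y A} \<and>
     (\<forall>A V. A \<in> \<H> \<inter> O_Z Y Z \<and> openin Y V \<and> A \<subseteq> V \<longrightarrow> V \<in> \<H>) \<and>
     (\<forall>\<C>. \<C> \<subseteq> O_Z Y Z \<and> \<Union>\<C> = topspace Y \<longrightarrow>
        (\<exists>\<F>. finite \<F> \<and> \<F> \<subseteq> \<C> \<and> \<Union>\<F> \<in> \<H>))}"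

definition subbasic_set :: "'y topology \<Rightarrow> 'z topology \<Rightarrow> 'y set set \<Rightarrow> 'z set \<Rightarrow> ('y \<Rightarrow> 'z) set" where
  "subbasic_set Y Z \<H> U = {f \<in> contmaps Y Z. preimage Y f U \<in> \<H>}"

definition t_1s :: "'y topology \<Rightarrow> 'z topology \<Rightarrow> ('y \<Rightarrow> 'z) topology" where
  "t_1s Y Z = subbasis_topology (contmaps Y Z)
     {subbasic_set Y Z \<H> U | \<H> U. \<H> \<in> tau_1s Y Z \<and> openin Z U}"

text \<open>The test spaces \<open>X\<close> have points in the type \<open>'x\<close>. A formula cannot quantify over types,
  so ``for every space \<open>X\<close>'' is expressed by leaving \<open>'x\<close> free in a theorem. The type
  \<^typ>\<open>'y \<Rightarrow> 'z\<close> alone already suffices: see \<open>admissible_iff_evaluation\<close> and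
  \<open>admissible_if_evaluation\<close>.\<close>

definition admissible ::
    "'x itself \<Rightarrow> 'y topology \<Rightarrow> 'z topology \<Rightarrow> ('y \<Rightarrow> 'z) topology \<Rightarrow> bool" where
  "admissible TYPE('x) Y Z t \<longleftrightarrow> topspace t = contmaps Y Z \<and>
     (\<forall>(X :: 'x topology) G. G \<in> topspace X \<rightarrow> contmaps Y Z \<and> continuous_map X t G \<longrightarrow>
        continuous_map (prod_topology X Y) Z (\<lambda>(x, y). G x y))"

lemma admissible_if_evaluation:
  fixes Y :: "'y topology" and Z :: "'z topology"
  assumes "topspace t = contmaps Y Z"
    and ev: "continuous_map (prod_topology t Y) Z (\<lambda>(f, y). f y)"
  shows "admissible TYPE('x) Y Z t"
  unfolding admissible_def
proof (intro conjI allI impI)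
  fix X :: "'x topology" and G
  assume "G \<in> topspace X \<rightarrow> contmaps Y Z \<and> continuous_map X t G"
  then have "continuous_map (prod_topology X Y) (prod_topology t Y) (\<lambda>(x, y). (G x, y))"
    using continuous_map_prod_top[of X Y t Y G "\<lambda>y. y"] by auto
  from continuous_map_compose[OF this ev]
  show "continuous_map (prod_topology X Y) Z (\<lambda>(x, y). G x y)"
    by (simp add: o_def case_prod_unfold)
qed fact

lemma admissible_iff_evaluation:
  fixes Y :: "'y topology" and Z :: "'z topology"
  shows "admissible TYPE('y \<Rightarrow> 'z) Y Z t \<longleftrightarrow>
    topspace t = contmaps Y Z \<and> continuous_map (prod_topology t Y) Z (\<lambda>(f, y). f y)"
proof
  assume "admissible TYPE('y \<Rightarrow> 'z) Y Z t"
  then have "topspace t = contmaps Y Z"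
    and *: "\<And>(X :: ('y \<Rightarrow> 'z) topology) G. G \<in> topspace X \<rightarrow> contmaps Y Z \<and> continuous_map X t G \<Longrightarrow>
        continuous_map (prod_topology X Y) Z (\<lambda>(x, y). G x y)"
    unfolding admissible_def by blast+
  then show "topspace t = contmaps Y Z \<and> continuous_map (prod_topology t Y) Z (\<lambda>(f, y). f y)"
    using *[of "\<lambda>f. f" t] by simp
qed (simp add: admissible_if_evaluation)

end

theory Submission
  imports Defs
begin

text \<open>Evaluation is continuous: if \<open>f y \<in> U\<close>, local boundedness gives a \<open>Z\<close>-bounded
  \<open>W \<in> \<O>\<^sub>Z(Y)\<close> with \<open>y \<in> W \<subseteq> f\<^sup>-\<^sup>1(U)\<close>. By boundedness of \<open>W\<close>, the family \<open>\<H>\<close> of open supersets of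
  \<open>W\<close> lies in \<open>\<tau>\<^sub>1\<^sub>,\<^sub>s\<close>, and evaluation maps the neighbourhood \<open>(\<H>, U) \<times> W\<close> of \<open>(f, y)\<close> into \<open>U\<close>.\<close>

lemma topspace_subbasis_topology [simp]: "topspace (subbasis_topology S \<B>) = S"
  unfolding subbasis_topology_def by (rule topspace_subbase)

text \<open>Finite intersections are taken relative to \<open>S\<close>, so a subbasis member enters
  only through its trace on \<open>S\<close>; \<open>B \<subseteq> S\<close> makes that trace
  \<open>B\<close> itself.\<close>

lemma openin_subbasis_topology:
  assumes "B \<in> \<B>" and "B \<subseteq> S"
  shows "openin (subbasis_topology S \<B>) B"
  unfolding subbasis_topology_def openin_subbase
  using assms
  by (intro arbitrary_union_of_inc relative_to_subset_inc finite_intersection_of_inc) auto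

lemma openin_preimage:
  assumes "f \<in> contmaps Y Z" and "openin Z U"
  shows "openin Y (preimage Y f U)"
  using assms unfolding contmaps_def preimage_def by (auto intro: openin_continuous_map_preimage)

lemma openin_O_Z: "A \<in> O_Z Y Z \<Longrightarrow> openin Y A"
  unfolding O_Z_def by (auto intro: openin_preimage)

lemma topspace_tau_YZ [simp]: "topspace (tau_YZ Y Z) = topspace Y"
  by (simp add: tau_YZ_def)

lemma openin_tau_YZ_O_Z: "A \<in> O_Z Y Z \<Longrightarrow> openin (tau_YZ Y Z) A"
  unfolding tau_YZ_def
  by (simp add: openin_subbasis_topology openin_O_Z openin_subset)

lemma topspace_t_1s [simp]: "topspace (t_1s Y Z) = contmaps Y Z"
  by (simp add: t_1s_def)

lemma openin_t_1s_subbasic_set: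
  assumes "\<H> \<in> tau_1s Y Z" and "openin Z U"
  shows "openin (t_1s Y Z) (subbasic_set Y Z \<H> U)"
  unfolding t_1s_def
  by (rule openin_subbasis_topology) (use assms in \<open>auto simp: subbasic_set_def\<close>)

text \<open>Closure under open supersets is immediate. For the covering condition, members of
  \<open>O_Z Y Z\<close> are open in \<open>tau_YZ Y Z\<close>, so a cover of Y by them is one to
  which the boundedness of \<open>W\<close> applies.\<close>

lemma open_supersets_in_tau_1s:
  assumes "Z_bounded Y Z W"
  shows "{V. openin Y V \<and> W \<subseteq> V} \<in> tau_1s Y Z"
proof -
  have "\<exists>\<F>. finite \<F> \<and> \<F> \<subseteq> \<C> \<and> openin Y (\<Union>\<F>) \<and> W \<subseteq> \<Union>\<F>"
    if \<C>: "\<C> \<subseteq> O_Z Y Z" "\<Union>\<C> = topspace Y" for \<C>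
  proof -
    have "\<forall>U\<in>\<C>. openin (tau_YZ Y Z) U" "\<Union>\<C> = topspace (tau_YZ Y Z)"
      using \<C> by (auto simp: openin_tau_YZ_O_Z)
    then obtain \<F> where "finite \<F>" "\<F> \<subseteq> \<C>" "W \<subseteq> \<Union>\<F>"
      using assms unfolding Z_bounded_def bounded_in_def by blast
    \<comment> \<open>Covering \<open>W\<close> is not enough: the family consists of sets open in
      \<open>Y\<close>, so the finite union must be open there too.\<close>
    moreover have "openin Y (\<Union>\<F>)"
      using \<open>\<F> \<subseteq> \<C>\<close> \<C> by (blast intro: openin_O_Z)
    ultimately show ?thesis
      by blast
  qed
  then show ?thesis
    by (auto simp: tau_1s_def)
qed

lemma continuous_map_evaluation:
  assumes "locally_Z_bounded Y Z"
  shows "continuous_map (prod_topology (t_1s Y Z) Y) Z (\<lambda>(f, y). f y)"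
  unfolding continuous_map_def
proof (intro conjI allI impI)
  show "(\<lambda>(f, y). f y) \<in> topspace (prod_topology (t_1s Y Z) Y) \<rightarrow> topspace Z"
    by (auto simp: contmaps_def continuous_map_def)
next
  fix U assume U: "openin Z U"
  let ?P = "{p \<in> topspace (prod_topology (t_1s Y Z) Y). (case p of (f, y) \<Rightarrow> f y) \<in> U}"
  show "openin (prod_topology (t_1s Y Z) Y) ?P"
    unfolding openin_prod_topology_alt
  proof (intro allI impI)
    fix f y assume "(f, y) \<in> ?P"
    then have f: "f \<in> contmaps Y Z" and "y \<in> preimage Y f U"
      by (auto simp: preimage_def)
    then obtain W where W: "W \<in> O_Z Y Z" "Z_bounded Y Z W" "y \<in> W" "W \<subseteq> preimage Y f U"
      using assms openin_preimage[OF f U] unfolding locally_Z_bounded_def by meson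
    let ?\<H> = "{V. openin Y V \<and> W \<subseteq> V}"
    have "f \<in> subbasic_set Y Z ?\<H> U"
      using f U W by (simp add: subbasic_set_def openin_preimage)
    \<comment> \<open>For g in the subbasic set, \<open>W\<close> lies in the preimage of
      \<open>U\<close> under g, so g sends every point of \<open>W\<close> into
      \<open>U\<close>.\<close>
    moreover have "subbasic_set Y Z ?\<H> U \<times> W \<subseteq> ?P"
      by (auto simp: subbasic_set_def preimage_def)
    ultimately show "\<exists>A B. openin (t_1s Y Z) A \<and> openin Y B \<and> f \<in> A \<and> y \<in> B \<and> A \<times> B \<subseteq> ?P"
      using openin_t_1s_subbasic_set[OF open_supersets_in_tau_1s[OF W(2)] U] openin_O_Z[OF W(1)] W(3)
      by blast
  qed
qed

theorem theorem2p8: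
  fixes Y :: "'y topology" and Z :: "'z topology"
  assumes "locally_Z_bounded Y Z"
  shows "admissible TYPE('x) Y Z (t_1s Y Z)"
  by (rule admissible_if_evaluation[OF topspace_t_1s continuous_map_evaluation[OF assms]])

end
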